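(* Any two loony forms $G,G'\in\mathbb{Im}^\infty$ satisfy $G=_{\mathbb{Im}^\infty}G'$.
   Context: Affine normal play forms $\mathbb{Np}^\infty$ are defined recursively: two atomic forms $\infty$ and $\overline{\infty}$ with no options; every other form is $G=\{G^{\mathcal L}\mid G^{\mathcal R}\}$ with finite nonempty sets of previously constructed forms as Left and Right options. Followers of $G$: $G$ and followers of its options. Disjunctive sum: $\infty+X=X+\infty=\infty$ for $X\neq\overline{\infty}$; $\overline{\infty}+X=X+\overline{\infty}=\overline{\infty}$ for $X\ne\infty$; $\infty+\overline{\infty}$ undefined; otherwise $G+H=\{G^L+H,G+H^L\mid G^R+H,G+H^R\}$. Outcomes: Left wins $\infty$ and Right wins $\overline{\infty}$ whoever moves; otherwise play alternates, Left moving first wins iff some Left option is won by Left moving second, Left moving second wins iff every Right option is won by Left moving first, symmetrically for Right. $o(G)\in\{\mathscr L,\mathscr N,\mathscr P,\mathscr R\}$: Left wins either way, first player wins, second player wins, Right wins either way. Conjugate $\overline G$: swaps $\infty,\overline\infty$, otherwise $\{\overline{G^R}\mid\overline{G^L}\}$. $G\notin\{\infty,\overline\infty\}$ is a Left-check if $\infty\in G^{\mathcal L}$, a Right-check if $\overline\infty\in G^{\mathcal R}$; $G$ is quiet if $G\notin\{\infty,\overline\infty\}$ and it is neither. Symmetric: $G\notin\{\infty,\overline\infty\}$ and $G^{\mathcal R}=\{\overline{G^L}:G^L\in G^{\mathcal L}\}$. Affine impartial: symmetric and all quiet followers symmetric; the set of these is $\mathbb{Im}^\infty$. For $G,H\in\mathbb{Im}^\infty$,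 $G=_{\mathbb{Im}^\infty}H$ iff $o(G+X)=o(H+X)$ for all $X\in\mathbb{Im}^\infty$. A form $G\in\mathbb{Np}^\infty$ is loony if $o(G+X)=\mathscr N$ for every quiet $X\in\mathbb{Np}^\infty$ with $o(X)\in\{\mathscr N,\mathscr P\}$. *)

theory Defs
  imports Main "HOL-Library.FSet"
begin

section \<open>Forms\<close>

text \<open>\<open>PInf\<close> is the atomic form infinity (won by Left), \<open>NInf\<close> the atomic form overlined
  infinity (won by Right). The datatype also contains terms with an empty set of options;
  the affine normal play forms are the members of \<open>Np_forms\<close>, which excludes these hereditarily.\<close>

datatype form =
    PInf
  | NInf
  | Form (left_opts: "form fset") (right_opts: "form fset")
  where
    "left_opts PInf = {||}"
  | "right_opts PInf = {||}"
  | "left_opts NInf = {||}"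
  | "right_opts NInf = {||}"

inductive_set Np_forms :: "form set" where
  PInf: "PInf \<in> Np_forms"
| NInf: "NInf \<in> Np_forms"
| Form: "\<lbrakk>Gl \<noteq> {||}; Gr \<noteq> {||}; \<And>G'. G' |\<in>| Gl \<Longrightarrow> G' \<in> Np_forms; \<And>G'. G' |\<in>| Gr \<Longrightarrow> G' \<in> Np_forms\<rbrakk>
    \<Longrightarrow> Form Gl Gr \<in> Np_forms"

inductive follower :: "form \<Rightarrow> form \<Rightarrow> bool" where
  self: "follower G G"
| left: "G' |\<in>| left_opts G \<Longrightarrow> follower H G' \<Longrightarrow> follower H G"
| right: "G' |\<in>| right_opts G \<Longrightarrow> follower H G' \<Longrightarrow> follower H G"

lemma size_left_option [termination_simp]:
  assumes "x |\<in>| Gl" shows "size x < size (Form Gl Gr)"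
proof -
  have "Suc (size x) \<le> size_fset size Gl"
    unfolding size_fset_overloaded_simps size_fset_simps
    using member_le_sum[of x "fset Gl" "\<lambda>x. Suc (size x)"] assms by simp
  then show ?thesis by simp
qed

lemma size_right_option [termination_simp]:
  assumes "x |\<in>| Gr" shows "size x < size (Form Gl Gr)"
proof -
  have "Suc (size x) \<le> size_fset size Gr"
    unfolding size_fset_overloaded_simps size_fset_simps
    using member_le_sum[of x "fset Gr" "\<lambda>x. Suc (size x)"] assms by simp
  then show ?thesis by simp
qed

section \<open>Disjunctive sum\<close>

text \<open>The sum of the two distinct atomic forms is left unspecified (\<open>undefined\<close>). The recursion
  never reaches that case unless it starts there, since each recursive call keeps one of the
  two summands, which is not atomic.\<close>

function form_sum :: "form \<Rightarrow> form \<Rightarrow> form"  (infixl \<open>\<boxplus>\<close> 65) where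
  "PInf \<boxplus> X = (if X = NInf then undefined else PInf)"
| "NInf \<boxplus> X = (if X = PInf then undefined else NInf)"
| "Form Gl Gr \<boxplus> PInf = PInf"
| "Form Gl Gr \<boxplus> NInf = NInf"
| "Form Gl Gr \<boxplus> Form Hl Hr =
     Form ((\<lambda>G'. G' \<boxplus> Form Hl Hr) |`| Gl |\<union>| (\<lambda>H'. Form Gl Gr \<boxplus> H') |`| Hl)
          ((\<lambda>G'. G' \<boxplus> Form Hl Hr) |`| Gr |\<union>| (\<lambda>H'. Form Gl Gr \<boxplus> H') |`| Hr)"
  by pat_completeness auto
termination
  by (relation "measure (\<lambda>(G, H). size G + size H)")
     (use size_left_option size_right_option in \<open>auto simp del: form.size\<close>)

section \<open>Outcomes\<close>

datatype player = Left | Right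

fun opponent :: "player \<Rightarrow> player" where
  "opponent Left = Right"
| "opponent Right = Left"

fun opts :: "player \<Rightarrow> form \<Rightarrow> form fset" where
  "opts Left G = left_opts G"
| "opts Right G = right_opts G"

lemma size_opts: "x |\<in>| opts m (Form Gl Gr) \<Longrightarrow> size x < size (Form Gl Gr)"
  by (cases m) (auto simp only: opts.simps form.sel size_left_option size_right_option)

text \<open>\<open>wins p m G\<close>: player \<open>p\<close> wins \<open>G\<close> when player \<open>m\<close> moves first.\<close>

function wins :: "player \<Rightarrow> player \<Rightarrow> form \<Rightarrow> bool" where
  "wins p m PInf = (p = Left)"
| "wins p m NInf = (p = Right)"
| "wins p m (Form Gl Gr) =
     (if p = m then (\<exists>G' |\<in>| opts m (Form Gl Gr). wins p (opponent m) G')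
      else (\<forall>G' |\<in>| opts m (Form Gl Gr). wins p (opponent m) G'))"
  by pat_completeness auto
termination
  by (relation "measure (\<lambda>(p, m, G). size G)")
     (use size_opts in \<open>auto simp del: form.size opts.simps\<close>)

datatype outcome = Out_L | Out_N | Out_P | Out_R

text \<open>By determinacy (\<open>wins_determined\<close>) the four cases are exhaustive, the last one being that
  Right wins whoever moves first; see \<open>outcome_iff\<close>.\<close>

definition outcome :: "form \<Rightarrow> outcome" where
  "outcome G =
     (if wins Left Left G \<and> wins Left Right G then Out_L
      else if wins Left Left G \<and> wins Right Right G then Out_N
      else if wins Right Left G \<and> wins Left Right G then Out_P
      else Out_R)"

lemma wins_determined: "wins Right m G \<longleftrightarrow> \<not> wins Left m G"
proof (induction G arbitrary: m)
  case (Form Gl Gr)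
  then show ?case by (cases m) auto
qed simp_all

lemma outcome_iff:
  "outcome G = Out_L \<longleftrightarrow> wins Left Left G \<and> wins Left Right G"
  "outcome G = Out_N \<longleftrightarrow> wins Left Left G \<and> wins Right Right G"
  "outcome G = Out_P \<longleftrightarrow> wins Right Left G \<and> wins Left Right G"
  "outcome G = Out_R \<longleftrightarrow> wins Right Left G \<and> wins Right Right G"
  by (auto simp: outcome_def wins_determined)

section \<open>Affine impartial forms\<close>

primrec conjugate :: "form \<Rightarrow> form" where
  "conjugate PInf = NInf"
| "conjugate NInf = PInf"
| "conjugate (Form Gl Gr) = Form (conjugate |`| Gr) (conjugate |`| Gl)"

definition left_check :: "form \<Rightarrow> bool" where
  "left_check G \<longleftrightarrow> G \<notin> {PInf, NInf} \<and> PInf |\<in>| left_opts G"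

definition right_check :: "form \<Rightarrow> bool" where
  "right_check G \<longleftrightarrow> G \<notin> {PInf, NInf} \<and> NInf |\<in>| right_opts G"

definition quiet :: "form \<Rightarrow> bool" where
  "quiet G \<longleftrightarrow> G \<notin> {PInf, NInf} \<and> \<not> left_check G \<and> \<not> right_check G"

definition symmetric_form :: "form \<Rightarrow> bool" where
  "symmetric_form G \<longleftrightarrow> G \<notin> {PInf, NInf} \<and> right_opts G = conjugate |`| left_opts G"

definition Im_forms :: "form set" where
  "Im_forms = {G \<in> Np_forms. symmetric_form G \<and> (\<forall>H. follower H G \<longrightarrow> quiet H \<longrightarrow> symmetric_form H)}"

definition Im_eq :: "form \<Rightarrow> form \<Rightarrow> bool"  (infix \<open>=\<^sub>I\<^sub>m\<close> 50) where
  "G =\<^sub>I\<^sub>m H \<longleftrightarrow> (\<forall>X \<in> Im_forms. outcome (G \<boxplus> X) = outcome (H \<boxplus> X))"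

definition loony :: "form \<Rightarrow> bool" where
  "loony G \<longleftrightarrow> G \<in> Np_forms \<and>
     (\<forall>X \<in> Np_forms. quiet X \<longrightarrow> outcome X \<in> {Out_N, Out_P} \<longrightarrow> outcome (G \<boxplus> X) = Out_N)"

end

theory Submission
  imports Defs
begin

text \<open>
  A symmetric form is its own conjugate, so its outcome is \<open>Out_N\<close> or \<open>Out_P\<close>. Hence for a loony
  \<open>G\<close> and an affine impartial \<open>X\<close> the sum has outcome \<open>Out_N\<close>: by looniness if \<open>X\<close> is quiet, and
  otherwise because by symmetry \<open>X\<close> is both a Left-check and a Right-check, so that whoever
  moves first in \<open>G \<boxplus> X\<close> wins at once.
\<close>

lemma conjugate_conjugate [simp]: "conjugate (conjugate G) = G"
proof (induction G)
  case (Form Gl Gr)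
  then have "(\<lambda>G. conjugate (conjugate G)) |`| Gl = Gl" "(\<lambda>G. conjugate (conjugate G)) |`| Gr = Gr"
    by force+
  then show ?case
    by (simp add: fset.map_comp comp_def)
qed simp_all

lemma conjugate_eq_self:
  assumes "symmetric_form G"
  shows "conjugate G = G"
proof (cases G)
  case (Form Gl Gr)
  with assms have "Gr = conjugate |`| Gl"
    by (simp add: symmetric_form_def)
  with Form show ?thesis
    by (simp add: fset.map_comp comp_def)
qed (use assms in \<open>simp_all add: symmetric_form_def\<close>)

text \<open>Conjugation swaps the two option sets at every level and the two atoms, so a strategy
  for one player becomes a strategy for the other.\<close>

lemma wins_conjugate: "wins p m (conjugate G) \<longleftrightarrow> wins (opponent p) (opponent m) G"
proof (induction G arbitrary: p m)
  case (Form Gl Gr)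
  then show ?case by (cases p; cases m) auto
next
  case PInf
  then show ?case by (cases p) auto
next
  case NInf
  then show ?case by (cases p) auto
qed

lemma outcome_symmetric_form:
  assumes "symmetric_form G"
  shows "outcome G \<in> {Out_N, Out_P}"
  \<comment> \<open>Self-conjugacy turns this instance into
    \<open>wins Left Left G = wins Right Right G\<close>, which excludes \<open>Out_L\<close> and
    \<open>Out_R\<close>.\<close>
  using wins_conjugate[of Left Left G] conjugate_eq_self[OF assms]
  by (auto simp: outcome_def wins_determined)

lemma symmetric_form_check_iff:
  assumes "symmetric_form G"
  shows "left_check G \<longleftrightarrow> right_check G"
proof -
  have "NInf = conjugate A \<longleftrightarrow> A = PInf" for A
    by (cases A) auto
  with assms show ?thesis
    by (auto simp: symmetric_form_def left_check_def right_check_def image_iff)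
qed

lemma outcome_sum_double_check:
  assumes "G \<notin> {PInf, NInf}" "left_check X" "right_check X"
  shows "outcome (G \<boxplus> X) = Out_N"
proof -
  obtain Gl Gr where G: "G = Form Gl Gr"
    using assms(1) by (cases G) auto
  obtain Xl Xr where X: "X = Form Xl Xr" "PInf |\<in>| Xl" "NInf |\<in>| Xr"
    using assms(2,3) by (cases X) (auto simp: left_check_def right_check_def)
  \<comment> \<open>As \<open>G\<close> is not atomic, it is absorbed by either atom: a move in
    \<open>X\<close> to an atom makes the whole sum that atom.\<close>
  have "PInf |\<in>| left_opts (G \<boxplus> X)" "NInf |\<in>| right_opts (G \<boxplus> X)"
    using G imageI[OF X(2), of "\<lambda>H. G \<boxplus> H"] imageI[OF X(3), of "\<lambda>H. G \<boxplus> H"] by (simp_all add: X(1))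
  then show ?thesis
    using G X(1) unfolding outcome_iff by (auto intro: bexI[of _ PInf] bexI[of _ NInf])
qed

lemma outcome_loony_sum:
  assumes "G \<in> Im_forms" "loony G" "X \<in> Im_forms"
  shows "outcome (G \<boxplus> X) = Out_N"
proof -
  have X: "X \<in> Np_forms" "symmetric_form X" and G: "G \<notin> {PInf, NInf}"
    using assms by (auto simp: Im_forms_def symmetric_form_def)
  show ?thesis
  proof (cases "quiet X")
    case True
    with assms(2) X outcome_symmetric_form show ?thesis
      unfolding loony_def by blast
  next
    case False
    \<comment> \<open>A symmetric form is not atomic, so failing to be quiet means being a check for
      some player, hence for both.\<close>
    with X(2) have "left_check X" "right_check X"
      using symmetric_form_check_iff[OF X(2)] by (auto simp: quiet_def symmetric_form_def)
    with G show ?thesis by (rule outcome_sum_double_check)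
  qed
qed

theorem theorem3p10:
  fixes G G' :: form
  assumes "G \<in> Im_forms" and "G' \<in> Im_forms" and "loony G" and "loony G'"
  shows "G =\<^sub>I\<^sub>m G'"
  using assms by (simp add: Im_eq_def outcome_loony_sum)

end
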